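(* Let $d_1,\dots,d_n$ be i.i.d. $\sim U[l,u]$. Then the Bucket method with $c$ buckets, applied to $d=(d_1,\dots,d_n)$ with scaling factor $b>0$, has an average runtime of $O(cn)$.
   Context: Problem: compute the projection of $d\in\mathbb{R}^n$ onto $\Delta_b=\{v\in\mathbb{R}^n:\sum_{i=1}^n v_i=b,\ v\ge 0\}$, which has entries $\max\{d_i-\tau,0\}$ for a unique $\tau\in\mathbb{R}$. Bucket method (input: vector $d$, scaling factor $b$, number of buckets $c$, maximum number of iterations $T$): set $\mathcal{I}:=\{1,\dots,n\}$, $\mathcal{I}_\tau:=\emptyset$. For $t=1,\dots,T$ (outer loop): (1) Set $\mathcal{I}_1,\dots,\mathcal{I}_c:=\emptyset$. For $j=1,\dots,c$: set $p_j:=(\max_{i\in\mathcal{I}}d_i-\min_{i\in\mathcal{I}}d_i)\cdot(c-j)/c+\min_{i\in\mathcal{I}}d_i$, where the maximum and minimum are computed once, over $\mathcal{I}$ at the start of outer iteration $t$, and reused for every $j$; then for each $i\in\mathcal{I}$ with $d_i\ge p_j$, set $\mathcal{I}_j:=\mathcal{I}_j\cup\{i\}$ and $\mathcal{I}:=\mathcal{I}\setminus\{i\}$. (2) For $j=1,\dots,c$ (inner loop): set $p:=\dfrac{\sum_{i\in\mathcal{I}_\tau}d_i+\sum_{i\in\mathcal{I}_j}d_i-b}{|\mathcal{I}_\tau|+|\mathcal{I}_j|}$. If $p\ge p_j$, set $\mathcal{I}:=\mathcal{I}_j$ and break the inner loop; else if $j<c$ and $p>\max_{i\in\mathcal{I}_{j+1}}d_i$,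 set $\mathcal{I}_\tau:=\mathcal{I}_\tau\cup\mathcal{I}_j$ and break the outer loop; else set $\mathcal{I}_\tau:=\mathcal{I}_\tau\cup\mathcal{I}_j$. After the loops set $\tau:=\left(\sum_{i\in\mathcal{I}_\tau}d_i-b\right)/|\mathcal{I}_\tau|$ and return $(\max\{d_i-\tau,0\})_{i=1}^n$. The sum over $\mathcal{I}_\tau$ is kept as a running sum. The number of iterations is set to $T=\log_c(R/D)$, where $R:=\max_i d_i-\min_i d_i$ is the range of $d$ and $D$ is the absolute numerical tolerance to which the final pivot is required to approximate $\tau$. "Average" refers to the i.i.d. uniform inputs. *)

theory Defs
  imports "HOL-Probability.Probability"
begin

text \<open>
  Every function below returns its result together with its cost in the unit-cost model:
  each arithmetic operation, each comparison and each insertion of an index into, or removal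
  from, an index set costs 1. Loop control is not charged separately, since every loop round
  already costs at least 1. A vector \<open>d\<close> of length \<open>n\<close> is a function on indices of
  which only the values on \<open>{1..n}\<close> are used.
\<close>

definition threshold :: "(nat \<Rightarrow> real) \<Rightarrow> nat \<Rightarrow> nat set \<Rightarrow> nat \<Rightarrow> real" where
  "threshold d c I j =
     (Max (d ` I) - Min (d ` I)) * (real c - real j) / real c + Min (d ` I)"

text \<open>
  \<open>distribute d p I k\<close> fills the buckets \<open>1, \<dots>, k\<close> in this order, starting from
  the index set \<open>I\<close> and empty buckets, and returns the indices that are left over and the
  buckets. Round \<open>j\<close> costs 5 operations for computing \<open>p j\<close>, one comparison for each
  index still present, and a removal and an insertion for each index moved.

  If \<open>I\<close> is empty, then the value of \<open>threshold d c I j\<close> is unspecified, but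
  all buckets are empty whatever it is.
\<close>

primrec distribute ::
  "(nat \<Rightarrow> real) \<Rightarrow> (nat \<Rightarrow> real) \<Rightarrow> nat set \<Rightarrow> nat \<Rightarrow> (nat set \<times> (nat \<Rightarrow> nat set)) \<times> nat" where
  "distribute d p I 0 = ((I, \<lambda>_. {}), 0)"
| "distribute d p I (Suc k) =
     (let ((I', B), t) = distribute d p I k;
          j = Suc k;
          M = {i \<in> I'. d i \<ge> p j}
      in ((I' - M, B(j := B j \<union> M)), t + 5 + card I' + 2 * card M))"

definition pivot :: "(nat \<Rightarrow> real) \<Rightarrow> real \<Rightarrow> nat set \<Rightarrow> nat set \<Rightarrow> real" where
  "pivot d b I\<tau> J =
     ((\<Sum>i\<in>I\<tau>. d i) + (\<Sum>i\<in>J. d i) - b) / (real (card I\<tau>) + real (card J))"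

text \<open>
  The test \<open>p > max d_i\<close> over an empty bucket has no canonical outcome: with the convention
  that the maximum is minus infinity it succeeds, whereas skipping empty buckets means that it
  fails. The outcome is therefore a parameter \<open>e\<close> of the method.
\<close>

definition exceeds_max :: "bool \<Rightarrow> (nat \<Rightarrow> real) \<Rightarrow> real \<Rightarrow> nat set \<Rightarrow> bool" where
  "exceeds_max e d p J = (if J = {} then e else p > Max (d ` J))"

text \<open>
  The inner loop, over the list of the bucket numbers still to be visited; \<open>js \<noteq> []\<close>
  is the test \<open>j < c\<close>. The result is the new index set, the new \<open>I\<tau>\<close>,
  and whether the outer loop is left; \<open>I\<close> is returned unchanged unless the first branch
  is taken.

  As the sum over \<open>I\<tau>\<close> is kept as a running sum (and its cardinality likewise), the pivot
  costs \<open>card (B j) + 3\<close>, and updating the running data is one further operation. The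
  comparison with \<open>p j\<close> and the test \<open>j < c\<close> cost 1 each.
\<close>

fun inner_loop ::
  "bool \<Rightarrow> (nat \<Rightarrow> real) \<Rightarrow> real \<Rightarrow> (nat \<Rightarrow> real) \<Rightarrow> (nat \<Rightarrow> nat set) \<Rightarrow> nat list \<Rightarrow> nat set \<Rightarrow> nat set
    \<Rightarrow> (nat set \<times> nat set \<times> bool) \<times> nat" where
  "inner_loop e d b p B [] I I\<tau> = ((I, I\<tau>, False), 0)"
| "inner_loop e d b p B (j # js) I I\<tau> =
     (let q = pivot d b I\<tau> (B j); t = card (B j) + 4 in
      if q \<ge> p j then ((B j, I\<tau>, False), t + card (B j))
      else
        let t' = t + 1 + (if js \<noteq> [] then card (B (Suc j)) + 1 else 0) + card (B j) + 1 in
        if js \<noteq> [] \<and> exceeds_max e d q (B (Suc j)) then ((I, I\<tau> \<union> B j, True), t')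
        else let (r, s) = inner_loop e d b p B js I (I\<tau> \<union> B j) in (r, t' + s))"

text \<open>
  Each round of the outer loop additionally costs \<open>2 * card I\<close> for the maximum and the
  minimum, and \<open>c\<close> for creating the empty buckets.
\<close>

primrec outer_loop ::
  "bool \<Rightarrow> (nat \<Rightarrow> real) \<Rightarrow> real \<Rightarrow> nat \<Rightarrow> nat \<Rightarrow> nat set \<Rightarrow> nat set \<Rightarrow> nat set \<times> nat" where
  "outer_loop e d b c 0 I I\<tau> = (I\<tau>, 0)"
| "outer_loop e d b c (Suc T) I I\<tau> =
     (let p = threshold d c I;
          ((I1, B), t1) = distribute d p I c;
          ((I2, I\<tau>2, stop), t2) = inner_loop e d b p B [1..<Suc c] I1 I\<tau>;
          t = 2 * card I + c + t1 + t2
      in if stop then (I\<tau>2, t)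
         else let (I\<tau>3, t3) = outer_loop e d b c T I2 I\<tau>2 in (I\<tau>3, t + t3))"

definition bucket_method ::
  "bool \<Rightarrow> nat \<Rightarrow> (nat \<Rightarrow> real) \<Rightarrow> real \<Rightarrow> nat \<Rightarrow> nat \<Rightarrow> (nat \<Rightarrow> real) \<times> nat" where
  "bucket_method e n d b c T =
     (let (I\<tau>, t) = outer_loop e d b c T {1..n} {};
          \<tau> = ((\<Sum>i\<in>I\<tau>. d i) - b) / real (card I\<tau>)
      in (\<lambda>i\<in>{1..n}. max (d i - \<tau>) 0, n + t + 2 + 2 * n))"

text \<open>
  The least number of iterations \<open>T\<close> with \<open>R / c ^ T \<le> D\<close>. It is 0 if \<open>R = 0\<close>,
  by \<open>ln 0 = 0\<close>.
\<close>

definition num_iterations :: "nat \<Rightarrow> (nat \<Rightarrow> real) \<Rightarrow> nat \<Rightarrow> real \<Rightarrow> nat" where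
  "num_iterations n d c D =
     nat \<lceil>log (real c) ((Max (d ` {1..n}) - Min (d ` {1..n})) / D)\<rceil>"

text \<open>
  Computing the number of iterations takes \<open>2 * n\<close> comparisons for the range and 4 further
  operations.
\<close>

definition bucket_runtime :: "bool \<Rightarrow> nat \<Rightarrow> (nat \<Rightarrow> real) \<Rightarrow> real \<Rightarrow> nat \<Rightarrow> real \<Rightarrow> nat" where
  "bucket_runtime e n d b c D =
     2 * n + 4 + snd (bucket_method e n d b c (num_iterations n d c D))"

end

theory Submission
  imports Defs
begin

text \<open>
  One round of the outer loop costs \<open>O(c |I| + c)\<close>, and every bucket has at most \<open>1/c \<le> 1/2\<close> of
  the diameter of the set it was split from, so after \<open>k\<close> rounds \<open>I\<close> has diameter at most
  \<open>(u - l) / 2 ^ k\<close>. Which bucket is kept depends on all the data, so \<open>|I|\<close> is bounded for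
  every set of that diameter at once: \<open>|I|\<^sup>2\<close> is at most the number of pairs of indices whose
  values differ by at most \<open>(u - l) / 2 ^ k\<close>, whose expectation is at most
  \<open>n + 2 n\<^sup>2 / 2 ^ k\<close>. Taking square roots gives a geometric series in \<open>k\<close>, up to an error of
  lower order in \<open>n\<close>, because the number of rounds is bounded in terms of \<open>l\<close>, \<open>u\<close>, \<open>D\<close>.
\<close>

section \<open>Deterministic analysis: cost of a round and shrinking of the index set\<close>

text \<open>Closed form that replaces the recursion: an index leaves at the first threshold it
  reaches. Disjointness, inclusion and diameter of the buckets are all read off from it.\<close>

lemma distribute_eq:
  "fst (distribute d p I k) =
     ({i \<in> I. \<forall>j\<in>{1..k}. d i < p j},
      \<lambda>j. if j \<in> {1..k} then {i \<in> I. d i \<ge> p j \<and> (\<forall>j'\<in>{1..<j}. d i < p j')} else {})"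
proof (induction k)
  case (Suc k)
  obtain I' B t where h: "distribute d p I k = ((I', B), t)"
    by (metis prod.exhaust)
  with Suc have I': "I' = {i \<in> I. \<forall>j\<in>{1..k}. d i < p j}"
    and B: "B = (\<lambda>j. if j \<in> {1..k}
      then {i \<in> I. d i \<ge> p j \<and> (\<forall>j'\<in>{1..<j}. d i < p j')} else {})"
    by auto
  have "(\<forall>j\<in>{1..Suc k}. P j) \<longleftrightarrow> P (Suc k) \<and> (\<forall>j\<in>{1..k}. P j)" for P
    by (simp add: atLeastAtMostSuc_conv)
  moreover have "{1..<Suc k} = {1..k}" by auto
  ultimately show ?case
    by (auto simp: h Let_def I' B fun_eq_iff simp del: One_nat_def)
qed auto

text \<open>Amortised count: \<open>2 * card\<close> of the leftover set is a potential, so that the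
  removal and insertion of an index are paid for by its leaving. Moves thus cost
  \<open>2 * card I\<close> over all rounds together.\<close>

lemma distribute_cost:
  assumes "finite I"
  shows "snd (distribute d p I k) + 2 * card (fst (fst (distribute d p I k)))
           \<le> 5 * k + k * card I + 2 * card I"
proof (induction k)
  case (Suc k)
  obtain I' B t where h: "distribute d p I k = ((I', B), t)"
    by (metis prod.exhaust)
  have I': "I' \<subseteq> I"
    using distribute_eq[of d p I k] h by auto
  then have fin: "finite I'" using assms finite_subset by blast
  define M where "M = {i \<in> I'. d i \<ge> p (Suc k)}"
  have M: "M \<subseteq> I'" "finite M" using fin by (auto simp: M_def)
  have "card (I' - M) + card M = card I'"
    using M fin by (metis card_Diff_subset card_mono le_add_diff_inverse2)
  moreover have "card I' \<le> card I" using I' assms card_mono by blast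
  ultimately show ?case
    using Suc by (simp add: h Let_def flip: M_def)
qed simp

lemma sum_card_buckets:
  assumes "finite I" "fst (distribute d p I k) = (I', B)"
  shows "(\<Sum>j\<in>{1..k}. card (B j)) \<le> card I"
proof -
  have B: "B = (\<lambda>j. if j \<in> {1..k}
      then {i \<in> I. d i \<ge> p j \<and> (\<forall>j'\<in>{1..<j}. d i < p j')} else {})"
    using assms(2) distribute_eq[of d p I k] by simp
  have "B i \<inter> B j = {}" if "i < j" "1 \<le> i" for i j
    using that by (force simp: B)
  then have disj: "\<forall>i\<in>{1..k}. \<forall>j\<in>{1..k}. i \<noteq> j \<longrightarrow> B i \<inter> B j = {}"
    by (metis Int_commute atLeastAtMost_iff nat_neq_iff)
  have "(\<Sum>j\<in>{1..k}. card (B j)) = card (\<Union>j\<in>{1..k}. B j)"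
    using disj assms(1) by (intro card_UN_disjoint[symmetric]) (auto simp: B)
  also have "\<dots> \<le> card I"
    using assms(1) by (intro card_mono) (auto simp: B split: if_splits)
  finally show ?thesis .
qed

text \<open>The summand is the price of the most expensive visit, one that evaluates both tests and
  updates the running data. Leaving the loop early only drops summands.\<close>

lemma inner_loop_cost:
  "snd (inner_loop e d b p B js I I\<tau>)
     \<le> (\<Sum>j\<leftarrow>js. 2 * card (B j) + card (B (Suc j)) + 7)"
proof (induction js arbitrary: I\<tau>)
  case (Cons j js)
  show ?case
    using Cons[of "I\<tau> \<union> B j"]
    by (auto simp: Let_def split: prod.splits)
qed simp

text \<open>The choice made by the pivots is never analysed. It suffices that the next index set is
  one of finitely many candidates, all of which have small diameter.\<close>

lemma inner_loop_result:
  "fst (fst (inner_loop e d b p B js I I\<tau>)) \<in> insert I (B ` set js)"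
proof (induction js arbitrary: I\<tau>)
  case (Cons j js)
  show ?case
    using Cons[of "I\<tau> \<union> B j"]
    by (auto simp: Let_def split: prod.splits)
qed simp

text \<open>Values in a bucket lie between two consecutive thresholds, which are a
  \<open>c\<close>-th part of the range apart. Weakening this to one half makes the bound
  independent of \<open>c\<close>.\<close>

lemma bucket_diameter:
  assumes I: "finite I" and c: "c \<ge> 2" and W: "\<forall>i\<in>I. \<forall>j\<in>I. d i - d j \<le> W"
    and B: "fst (distribute d (threshold d c I) I c) = (I', B)"
    and J: "J \<in> insert I' (range B)"
  shows "J \<subseteq> I" "\<forall>i\<in>J. \<forall>j\<in>J. d i - d j \<le> W / 2"
proof -
  let ?p = "threshold d c I"
  have I'_eq: "I' = {i \<in> I. \<forall>j\<in>{1..c}. d i < ?p j}"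
    and B_eq: "B = (\<lambda>j. if j \<in> {1..c}
      then {i \<in> I. d i \<ge> ?p j \<and> (\<forall>j'\<in>{1..<j}. d i < ?p j')} else {})"
    using B distribute_eq[of d ?p I c] by simp_all
  show "J \<subseteq> I" using J by (auto simp: I'_eq B_eq split: if_splits)
  show "\<forall>i\<in>J. \<forall>j\<in>J. d i - d j \<le> W / 2"
  proof (intro ballI)
    fix i j assume ij: "i \<in> J" "j \<in> J"
    with \<open>J \<subseteq> I\<close> have ijI: "i \<in> I" "j \<in> I" by auto
    have Min: "Min (d ` I) \<le> d x" and Max: "d x \<le> Max (d ` I)" if "x \<in> I" for x
      using that I by auto
    have "Max (d ` I) \<in> d ` I" "Min (d ` I) \<in> d ` I"
      using I ijI by (intro Max_in Min_in; auto)+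
    then have R: "Max (d ` I) - Min (d ` I) \<le> W" using W by auto
    \<comment> \<open>The last threshold is the minimum, which every index reaches, so nothing is
      left over and the nonempty \<open>J\<close> must be a bucket.\<close>
    have "?p c = Min (d ` I)" by (simp add: threshold_def)
    moreover have "c \<in> {1..c}" using c by simp
    ultimately have "I' = {}"
      using Min unfolding I'_eq by (metis (mono_tags, lifting) empty_Collect_eq linorder_not_le)
    with J ij obtain k where k: "J = B k" by auto
    with ij have k1: "k \<in> {1..c}" by (auto simp: B_eq split: if_splits)
    \<comment> \<open>The method has no threshold 0, but the formula evaluates to the maximum there,
      so the first bucket fits the same pattern.\<close>
    have di: "d i \<le> ?p (k - 1)"
    proof (cases "k = 1")
      case True
      then show ?thesis using Max[OF ijI(1)] c by (simp add: threshold_def)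
    next
      case False
      then have "k - 1 \<in> {1..<k}" using k1 by auto
      then show ?thesis using ij(1) k k1 by (force simp: B_eq)
    qed
    have dj: "?p k \<le> d j" using ij(2) k k1 by (simp add: B_eq)
    have "d i - d j \<le> ?p (k - 1) - ?p k" using di dj by simp
    also have "\<dots> = (Max (d ` I) - Min (d ` I)) / real c"
      using k1 c by (simp add: threshold_def of_nat_diff field_simps)
    also have "\<dots> \<le> (Max (d ` I) - Min (d ` I)) / 2"
      using Min[OF ijI(1)] Max[OF ijI(1)] c by (intro divide_left_mono) auto
    also have "\<dots> \<le> W / 2" using R by (rule divide_right_mono) simp
    finally show "d i - d j \<le> W / 2" .
  qed
qed

text \<open>The bound \<open>f\<close> applies to all sets of the given diameter at once, so it
  covers whichever bucket is kept. The offset \<open>m\<close> counts the rounds already done and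
  lets the induction pass to a smaller diameter.\<close>

lemma outer_loop_cost:
  fixes f :: "nat \<Rightarrow> real"
  assumes S: "finite S" and c: "c \<ge> 2"
    and f: "\<And>k J. J \<subseteq> S \<Longrightarrow> \<forall>i\<in>J. \<forall>j\<in>J. d i - d j \<le> W / 2 ^ k \<Longrightarrow> real (card J) \<le> f k"
  shows "I \<subseteq> S \<Longrightarrow> \<forall>i\<in>I. \<forall>j\<in>I. d i - d j \<le> W / 2 ^ m \<Longrightarrow>
    real (snd (outer_loop e d b c T I I\<tau>)) \<le> (\<Sum>k=m..<m+T. 13 * real c + 8 * real c * f k)"
proof (induction T arbitrary: I I\<tau> m)
  case (Suc T)
  let ?p = "threshold d c I"
  have f0: "0 \<le> f k" for k using f[of "{}" k] by simp
  have fin: "finite I" using Suc.prems S finite_subset by blast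
  obtain I1 B t1 where h1: "distribute d ?p I c = ((I1, B), t1)"
    by (metis prod.exhaust)
  obtain I2 I\<tau>2 stop t2
    where h2: "inner_loop e d b ?p B [1..<Suc c] I1 I\<tau> = ((I2, I\<tau>2, stop), t2)"
    by (metis prod.exhaust)
  obtain I3 t3 where h3: "outer_loop e d b c T I2 I\<tau>2 = (I3, t3)"
    by (metis prod.exhaust)
  have "I2 \<in> insert I1 (range B)"
    using inner_loop_result[of e d b ?p B "[1..<Suc c]" I1 I\<tau>] h2 by auto
  then have I2: "I2 \<subseteq> I" "\<forall>i\<in>I2. \<forall>j\<in>I2. d i - d j \<le> W / 2 ^ m / 2"
    using bucket_diameter[OF fin c Suc.prems(2), of I1 B I2] h1 by simp_all
  have t3: "real t3 \<le> (\<Sum>k=Suc m..<Suc m+T. 13 * real c + 8 * real c * f k)"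
    using Suc.IH[of I2 "Suc m" I\<tau>2] I2 Suc.prems(1) h3 by (simp add: field_simps)
  have t1: "t1 \<le> 5 * c + c * card I + 2 * card I"
    using distribute_cost[OF fin, of d ?p c] h1 by simp
  have Bsum: "(\<Sum>j\<in>{1..c}. card (B j)) \<le> card I"
    using sum_card_buckets[OF fin, of d ?p c I1 B] h1 by simp
  \<comment> \<open>The shifted sum of bucket sizes below reaches index \<open>c + 1\<close>, where
    there is no bucket.\<close>
  have Bc: "B (Suc c) = {}"
    using distribute_eq[of d ?p I c] h1 by simp
  have "t2 \<le> (\<Sum>j\<leftarrow>[1..<Suc c]. 2 * card (B j) + card (B (Suc j)) + 7)"
    using inner_loop_cost[of e d b ?p B "[1..<Suc c]" I1 I\<tau>] h2 by simp
  also have "\<dots> = (\<Sum>j\<in>{1..c}. 2 * card (B j) + card (B (Suc j)) + 7)"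
    by (subst sum.list_conv_set_nth[symmetric] sum_set_upt_conv_sum_list_nat[symmetric])
       (simp add: atLeastLessThanSuc_atLeastAtMost del: upt_Suc)
  also have "\<dots> = 2 * (\<Sum>j\<in>{1..c}. card (B j)) + (\<Sum>j\<in>{1..c}. card (B (Suc j))) + 7 * c"
    by (simp add: sum.distrib sum_distrib_left)
  also have "(\<Sum>j\<in>{1..c}. card (B (Suc j))) = (\<Sum>j\<in>{Suc 1..Suc c}. card (B j))"
    by (rule sum.shift_bounds_cl_Suc_ivl[symmetric])
  also have "\<dots> \<le> (\<Sum>j\<in>{1..Suc c}. card (B j))"
    by (rule sum_mono2) auto
  also have "\<dots> = (\<Sum>j\<in>{1..c}. card (B j))" by (simp add: Bc)
  finally have t2: "t2 \<le> 3 * card I + 7 * c" using Bsum by linarith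
  \<comment> \<open>Here 13 = 1 + 5 + 7 and 7 = 2 + 2 + 3, each in the order: set-up of the round,
    distribution, inner loop.\<close>
  have "2 * card I + c + t1 + t2 \<le> 13 * c + c * card I + 7 * card I" 
    using t1 t2 by linarith
  also have "7 * card I \<le> 7 * (c * card I)" using c by simp
  finally have "2 * card I + c + t1 + t2 \<le> 13 * c + 8 * (c * card I)" by simp
  then have "real (2 * card I + c + t1 + t2) \<le> real (13 * c + 8 * (c * card I))"
    by (rule of_nat_mono)
  also have "\<dots> \<le> 13 * real c + 8 * real c * f m"
    using f[OF Suc.prems] by (simp add: mult_left_mono)
  finally have t: "real (2 * card I + c + t1 + t2) \<le> 13 * real c + 8 * real c * f m" .
  \<comment> \<open>If \<open>stop\<close> holds, the term \<open>t3\<close> is a harmless surplus,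
    so both cases share one bound.\<close>
  have "real (snd (outer_loop e d b c (Suc T) I I\<tau>)) \<le> real (2 * card I + c + t1 + t2) + real t3"
    by (simp add: Let_def h1 h2 h3 del: upt_Suc One_nat_def)
  also have "\<dots> \<le> (\<Sum>k=m..<m+Suc T. 13 * real c + 8 * real c * f k)"
    using t t3 by (simp add: sum.atLeast_Suc_lessThan[of m] del: sum.op_ivl_Suc)
  finally show ?case .
qed simp

section \<open>Runtime and number of rounds for a fixed input\<close>

text \<open>Replacing the data-dependent number of rounds by a fixed \<open>T\<close> gives a sum of
  fixed length, whose expectation can be taken term by term. The overhead is
  \<open>2 * n + 4\<close> for the number of rounds and \<open>3 * n + 2\<close> around the outer
  loop.\<close>

lemma bucket_runtime_le:
  fixes f :: "nat \<Rightarrow> real"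
  assumes c: "c \<ge> 2" and W: "\<forall>i\<in>{1..n}. \<forall>j\<in>{1..n}. d i - d j \<le> W"
    and f: "\<And>k J. J \<subseteq> {1..n} \<Longrightarrow> \<forall>i\<in>J. \<forall>j\<in>J. d i - d j \<le> W / 2 ^ k \<Longrightarrow> real (card J) \<le> f k"
    and T: "num_iterations n d c D \<le> T"
  shows "real (bucket_runtime e n d b c D)
    \<le> 5 * real n + 6 + (\<Sum>k<T. 13 * real c + 8 * real c * f k)"
proof -
  let ?T = "num_iterations n d c D"
  \<comment> \<open>The empty set shows that \<open>f\<close> is nonnegative, so counting surplus
    rounds only enlarges the sum.\<close>
  have f0: "0 \<le> f k" for k using f[of "{}" k] by simp
  have "real (snd (outer_loop e d b c ?T {1..n} {})) \<le> (\<Sum>k<?T. 13 * real c + 8 * real c * f k)"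
    using outer_loop_cost[of "{1..n}" c d W f "{1..n}" 0 e b ?T "{}"] c W f
    by (simp add: atLeast0LessThan)
  also have "\<dots> \<le> (\<Sum>k<T. 13 * real c + 8 * real c * f k)"
    using T f0 by (intro sum_mono2) auto
  finally show ?thesis
    by (simp add: bucket_runtime_def bucket_method_def Let_def case_prod_beta)
qed

lemma num_iterations_le:
  assumes "l < u" "D > 0" "c \<ge> 2" "n \<ge> 1" and d: "\<And>i. i \<in> {1..n} \<Longrightarrow> d i \<in> {l..u}"
  shows "num_iterations n d c D \<le> nat \<lceil>log 2 ((u - l) / D)\<rceil>"
proof -
  define R where "R = Max (d ` {1..n}) - Min (d ` {1..n})"
  have "Max (d ` {1..n}) \<in> d ` {1..n}" "Min (d ` {1..n}) \<in> d ` {1..n}"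
    using assms(4) by (intro Max_in Min_in; auto)+
  then have R: "R \<le> u - l" using d unfolding R_def by (auto, smt (verit))
  show ?thesis
  \<comment> \<open>Lowering the base from \<open>c\<close> to 2 enlarges only nonnegative
    logarithms. In the other case the logarithm is at most 0 (with \<open>ln 0 = 0\<close> if
    \<open>R = 0\<close>) and \<open>nat\<close> truncates it to 0.\<close>
  proof (cases "R / D \<le> 1")
    case True
    have "R \<ge> 0" unfolding R_def using assms(4) by (simp add: Min_le_iff)
    then have "ln (R / D) \<le> 0" 
      using True assms(2) by (cases "R = 0") (auto simp: ln_le_zero_iff)
    then have "log (real c) (R / D) \<le> 0"
      using assms(3) unfolding log_def by (intro divide_nonpos_nonneg) auto
    then have "\<lceil>log (real c) (R / D)\<rceil> \<le> 0" by simp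
    then show ?thesis unfolding num_iterations_def R_def by linarith
  next
    case False
    have "log (real c) (R / D) \<le> log 2 (R / D)"
      unfolding log_def using False assms(3) by (intro divide_left_mono) auto
    also have "\<dots> \<le> log 2 ((u - l) / D)"
      using False R assms(1,2) by (intro log_mono) (auto simp: divide_right_mono)
    finally show ?thesis
      unfolding num_iterations_def R_def by (intro nat_mono ceiling_mono)
  qed
qed

section \<open>Counting close pairs\<close>

text \<open>Pairs are ordered and include the diagonal, so that a set of diameter at most \<delta>
  accounts for exactly the square of its cardinality.\<close>

definition close_pairs :: "(nat \<Rightarrow> real) \<Rightarrow> nat \<Rightarrow> real \<Rightarrow> real" where
  "close_pairs d n \<delta> = (\<Sum>i\<in>{1..n}. \<Sum>j\<in>{1..n}. of_bool (\<bar>d i - d j\<bar> \<le> \<delta>))"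

lemma card_square_le_close_pairs:
  assumes "J \<subseteq> {1..n}" "\<forall>i\<in>J. \<forall>j\<in>J. d i - d j \<le> \<delta>"
  shows "(real (card J))\<^sup>2 \<le> close_pairs d n \<delta>"
proof -
  have fin: "finite J" using assms(1) finite_subset by blast
  have "\<bar>d i - d j\<bar> \<le> \<delta>" if "i \<in> J" "j \<in> J" for i j
    using assms(2) that by (force simp: abs_le_iff)
  then have "(real (card J))\<^sup>2 = (\<Sum>i\<in>J. \<Sum>j\<in>J. of_bool (\<bar>d i - d j\<bar> \<le> \<delta>))"
    by (simp add: power2_eq_square)
  also have "\<dots> \<le> (\<Sum>i\<in>J. \<Sum>j\<in>{1..n}. of_bool (\<bar>d i - d j\<bar> \<le> \<delta>))"
    using assms(1) by (intro sum_mono sum_mono2) auto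
  also have "\<dots> \<le> close_pairs d n \<delta>"
    unfolding close_pairs_def using assms(1) by (intro sum_mono2 sum_nonneg) auto
  finally show ?thesis .
qed

text \<open>By AM-GM; \<open>\<alpha>\<close> is a guess for the size of \<open>J\<close>.\<close>

lemma card_le_close_pairs:
  assumes "J \<subseteq> {1..n}" "\<forall>i\<in>J. \<forall>j\<in>J. d i - d j \<le> \<delta>" "\<alpha> > 0"
  shows "real (card J) \<le> (\<alpha> + close_pairs d n \<delta> / \<alpha>) / 2"
proof -
  have "2 * real (card J) * \<alpha> \<le> \<alpha>\<^sup>2 + (real (card J))\<^sup>2"
    using sum_squares_bound[of "real (card J)" \<alpha>] by simp
  also have "\<dots> \<le> \<alpha>\<^sup>2 + close_pairs d n \<delta>"
    using card_square_le_close_pairs[OF assms(1,2)] by simp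
  finally show ?thesis
    using assms(3) by (simp add: field_simps power2_eq_square)
qed

section \<open>Measurability of the runtime\<close>

text \<open>Keeps \<open>I\<tau>\<close> inside the index set on which the data are measurable, as
  the induction over the outer loop requires.\<close>

lemma inner_loop_tau_subset:
  "fst (snd (fst (inner_loop e d b p B js I I\<tau>))) \<subseteq> I\<tau> \<union> (\<Union>j\<in>set js. B j)"
proof (induction js arbitrary: I\<tau>)
  case (Cons j js)
  show ?case
    using Cons[of "I\<tau> \<union> B j"]
    by (auto simp: Let_def split: prod.splits)
qed simp

text \<open>The state of the method ranges over a finite set, so that measurability can be shown by
  conditioning on it.\<close>

lemma simple_function_bind:
  assumes X: "simple_function M X"
    and g: "\<And>x. x \<in> X ` space M \<Longrightarrow> simple_function M (g x)"
  shows "simple_function M (\<lambda>\<omega>. g (X \<omega>) \<omega>)"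
  unfolding simple_function_eq_measurable
proof
  have fin: "finite (X ` space M)" using X by (rule simple_functionD)
  have "(\<lambda>\<omega>. g (X \<omega>) \<omega>) ` space M \<subseteq> (\<Union>x\<in>X ` space M. g x ` space M)" by auto
  then show "finite ((\<lambda>\<omega>. g (X \<omega>) \<omega>) ` space M)"
    by (rule finite_subset) (intro finite_UN_I fin simple_functionD(1) g)
  \<comment> \<open>The target is the range of \<open>X\<close> because \<open>g\<close> is
    controlled only at values that are attained.\<close>
  have "X \<in> measurable M (count_space (X ` space M))"
    using simple_functionD(2)[OF X] by (auto simp: measurable_def)
  with g show "(\<lambda>\<omega>. g (X \<omega>) \<omega>) \<in> M \<rightarrow>\<^sub>M count_space UNIV"
    by (rule measurable_compose_countable'[OF measurable_simple_function])
      (use fin in \<open>auto intro: countable_finite\<close>)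
qed

lemma simple_function_filter:
  assumes "finite I" "\<And>i. i \<in> I \<Longrightarrow> Measurable.pred M (P i)"
  shows "simple_function M (\<lambda>\<omega>. {i \<in> I. P i \<omega>})"
  using assms
proof (induction I)
  case (insert a I)
  have eq: "{i \<in> insert a I. P i \<omega>} = (if P a \<omega> then insert a {i \<in> I. P i \<omega>} else {i \<in> I. P i \<omega>})"
    for \<omega> by auto
  have "simple_function M (\<lambda>\<omega>. {i \<in> I. P i \<omega>})" using insert by auto
  then show ?case
    unfolding eq using insert.prems[of a]
    by (intro simple_function_If simple_function_compose1[where g = "insert a"]) auto
qed simp

text \<open>The data enter only through finitely many comparisons, so buckets and cost together take
  finitely many values. Each round is conditioned on the outcome of the previous ones.\<close>

lemma simple_function_distribute:
  fixes d p :: "nat \<Rightarrow> 'a \<Rightarrow> real"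
  assumes I: "finite I" and d: "\<And>i. i \<in> I \<Longrightarrow> d i \<in> borel_measurable M"
    and p: "\<And>j. p j \<in> borel_measurable M"
  shows "simple_function M (\<lambda>\<omega>. distribute (\<lambda>i. d i \<omega>) (\<lambda>j. p j \<omega>) I k)"
proof (induction k)
  case (Suc k)
  let ?X = "\<lambda>\<omega>. distribute (\<lambda>i. d i \<omega>) (\<lambda>j. p j \<omega>) I k"
  define g where "g = (\<lambda>((I', B), t) \<omega>. let j = Suc k; N = {i \<in> I'. d i \<omega> \<ge> p j \<omega>}
      in ((I' - N, B(j := B j \<union> N)), t + 5 + card I' + 2 * card N))"
  have "simple_function M (\<lambda>\<omega>. g (?X \<omega>) \<omega>)"
  proof (rule simple_function_bind[OF Suc])
    fix s assume s: "s \<in> ?X ` space M"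
    obtain I' B t where s_eq: "s = ((I', B), t)" by (metis prod.exhaust)
    \<comment> \<open>An attained state has \<open>I' \<subseteq> I\<close>, and measurability of
      \<open>d i\<close> is known only for \<open>i\<close> in \<open>I\<close>.\<close>
    obtain \<omega> where "((I', B), t) = ?X \<omega>" using s s_eq by auto
    then have "(I', B) = fst (?X \<omega>)" by (metis fst_conv)
    then have I': "I' \<subseteq> I" by (auto simp: distribute_eq)
    have "simple_function M (\<lambda>\<omega>. {i \<in> I'. d i \<omega> \<ge> p (Suc k) \<omega>})"
    proof (rule simple_function_filter)
      show "finite I'" using I' I finite_subset by blast
      fix i assume "i \<in> I'"
      then have [measurable]: "d i \<in> borel_measurable M" using I' d by auto
      note p[measurable]
      show "Measurable.pred M (\<lambda>\<omega>. p (Suc k) \<omega> \<le> d i \<omega>)" by measurable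
    qed
    then show "simple_function M (g s)"
      unfolding g_def s_eq Let_def prod.case by (rule simple_function_compose1)
  qed
  moreover have "g (?X \<omega>) \<omega> = distribute (\<lambda>i. d i \<omega>) (\<lambda>j. p j \<omega>) I (Suc k)" for \<omega>
    by (simp add: g_def case_prod_beta)
  ultimately show ?case by simp
qed simp

text \<open>Buckets and \<open>I\<tau>\<close> are fixed here since the outer loop conditions on
  them. The pivot is then a measurable real function and each branch test a measurable
  predicate.\<close>

lemma simple_function_inner_loop:
  fixes d p :: "nat \<Rightarrow> 'a \<Rightarrow> real"
  assumes S: "finite S" and d: "\<And>i. i \<in> S \<Longrightarrow> d i \<in> borel_measurable M"
    and p: "\<And>j. p j \<in> borel_measurable M" and B: "\<And>j. B j \<subseteq> S"
  shows "I\<tau> \<subseteq> S \<Longrightarrow>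
    simple_function M (\<lambda>\<omega>. inner_loop e (\<lambda>i. d i \<omega>) b (\<lambda>j. p j \<omega>) B js I I\<tau>)"
proof (induction js arbitrary: I\<tau>)
  case (Cons j js)
  note p[measurable]
  have pivot [measurable]: "(\<lambda>\<omega>. pivot (\<lambda>i. d i \<omega>) b I\<tau> (B j)) \<in> borel_measurable M"
    unfolding pivot_def using d B Cons.prems
    by (intro borel_measurable_divide borel_measurable_diff borel_measurable_add
        borel_measurable_sum borel_measurable_const) auto
  have max: "Measurable.pred M
      (\<lambda>\<omega>. exceeds_max e (\<lambda>i. d i \<omega>) (pivot (\<lambda>i. d i \<omega>) b I\<tau> (B j)) (B (Suc j)))"
  proof (cases "B (Suc j) = {}")
    case False
    have [measurable]: "(\<lambda>\<omega>. Max ((\<lambda>i. d i \<omega>) ` B (Suc j))) \<in> borel_measurable M"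
      using B d finite_subset[OF B S] by (intro borel_measurable_Max) auto
    show ?thesis using False by (simp add: exceeds_max_def)
  qed (simp add: exceeds_max_def)
  have IH: "simple_function M
      (\<lambda>\<omega>. inner_loop e (\<lambda>i. d i \<omega>) b (\<lambda>j. p j \<omega>) B js I (I\<tau> \<union> B j))"
    using Cons B by auto
  show ?case
    unfolding inner_loop.simps Let_def using max
    by (intro simple_function_If simple_function_const simple_function_compose1[OF IH]) 
       (auto intro!: predE)
qed simp

lemma borel_measurable_threshold:
  assumes "finite I" and "\<And>i. i \<in> I \<Longrightarrow> d i \<in> borel_measurable M"
  shows "(\<lambda>\<omega>. threshold (\<lambda>i. d i \<omega>) c I j) \<in> borel_measurable M"
proof -
  have [measurable]: "(\<lambda>\<omega>. Max ((\<lambda>i. d i \<omega>) ` I)) \<in> borel_measurable M"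
    "(\<lambda>\<omega>. Min ((\<lambda>i. d i \<omega>) ` I)) \<in> borel_measurable M"
    using assms by (auto intro: borel_measurable_Max borel_measurable_Min)
  show ?thesis unfolding threshold_def by measurable
qed

lemma simple_function_outer_loop:
  fixes d :: "nat \<Rightarrow> 'a \<Rightarrow> real"
  assumes S: "finite S" and d: "\<And>i. i \<in> S \<Longrightarrow> d i \<in> borel_measurable M"
  shows "I \<subseteq> S \<Longrightarrow> I\<tau> \<subseteq> S \<Longrightarrow>
    simple_function M (\<lambda>\<omega>. outer_loop e (\<lambda>i. d i \<omega>) b c T I I\<tau>)"
proof (induction T arbitrary: I I\<tau>)
  case (Suc T)
  let ?p = "\<lambda>\<omega>. threshold (\<lambda>i. d i \<omega>) c I"
  let ?X = "\<lambda>\<omega>. distribute (\<lambda>i. d i \<omega>) (?p \<omega>) I c"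
  let ?Y = "\<lambda>I1 B \<omega>. inner_loop e (\<lambda>i. d i \<omega>) b (?p \<omega>) B [1..<Suc c] I1 I\<tau>"
  \<comment> \<open>Two nested conditionings: \<open>g\<close> continues the round once the buckets
    are known, and \<open>h\<close> continues it once the result of the inner loop is known as
    well.\<close>
  define h where "h = (\<lambda>t1 ((I2, I\<tau>2, stop), t2) \<omega>.
      let t = 2 * card I + c + t1 + t2 in if stop then (I\<tau>2, t)
         else let (I\<tau>3, t3) = outer_loop e (\<lambda>i. d i \<omega>) b c T I2 I\<tau>2 in (I\<tau>3, t + t3))"
  define g where "g = (\<lambda>((I1, B), t1) \<omega>. h t1 (?Y I1 B \<omega>) \<omega>)"
  have fin: "finite I" using Suc.prems S finite_subset by blast
  have p: "(\<lambda>\<omega>. ?p \<omega> j) \<in> borel_measurable M" for j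
    using Suc.prems d fin by (intro borel_measurable_threshold) auto
  have "simple_function M ?X"
    using simple_function_distribute[where p = "\<lambda>j \<omega>. ?p \<omega> j", OF fin _ p] d Suc.prems by auto
  then have "simple_function M (\<lambda>\<omega>. g (?X \<omega>) \<omega>)"
  proof (rule simple_function_bind)
    fix s assume s: "s \<in> ?X ` space M"
    obtain I1 B t1 where s_eq: "s = ((I1, B), t1)" by (metis prod.exhaust)
    obtain \<omega> where "((I1, B), t1) = ?X \<omega>" using s s_eq by auto
    then have "(I1, B) = fst (?X \<omega>)" by (metis fst_conv)
    then have I1: "I1 \<subseteq> S" and B: "B j \<subseteq> S" for j
      using Suc.prems by (auto simp: distribute_eq)
    have "simple_function M (?Y I1 B)"
      using simple_function_inner_loop[where p = "\<lambda>j \<omega>. ?p \<omega> j", OF S d p B] Suc.prems by auto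
    then have "simple_function M (\<lambda>\<omega>. h t1 (?Y I1 B \<omega>) \<omega>)"
    proof (rule simple_function_bind)
      fix r assume r: "r \<in> ?Y I1 B ` space M"
      obtain I2 I\<tau>2 stop t2 where r_eq: "r = ((I2, I\<tau>2, stop), t2)" by (metis prod.exhaust)
      obtain \<omega> where "((I2, I\<tau>2, stop), t2) = ?Y I1 B \<omega>" using r r_eq by auto
      then have "I2 = fst (fst (?Y I1 B \<omega>))" "I\<tau>2 = fst (snd (fst (?Y I1 B \<omega>)))"
        by (metis fst_conv snd_conv)+
      then have "I2 \<in> insert I1 (B ` set [1..<Suc c])"
        "I\<tau>2 \<subseteq> I\<tau> \<union> (\<Union>j\<in>set [1..<Suc c]. B j)"
        by (metis inner_loop_result, metis inner_loop_tau_subset)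
      then have "I2 \<subseteq> S" "I\<tau>2 \<subseteq> S" using I1 B Suc.prems(2) by blast+
      then have "simple_function M (\<lambda>\<omega>. outer_loop e (\<lambda>i. d i \<omega>) b c T I2 I\<tau>2)"
        by (rule Suc.IH)
      then show "simple_function M (h t1 r)"
        unfolding h_def r_eq Let_def prod.case
        by (cases stop) (auto intro: simple_function_compose1)
    qed
    then show "simple_function M (g s)" by (simp add: g_def s_eq)
  qed
  moreover have "g (?X \<omega>) \<omega> = outer_loop e (\<lambda>i. d i \<omega>) b c (Suc T) I I\<tau>" for \<omega>
    by (simp add: g_def h_def case_prod_beta Let_def del: upt_Suc)
  ultimately show ?case by simp
qed simp

text \<open>The number of rounds depends on the data but has countably many values. For each fixed
  number the cost is a simple function.\<close>

lemma measurable_bucket_runtime: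
  fixes d :: "nat \<Rightarrow> 'a \<Rightarrow> real"
  assumes d: "\<And>i. i \<in> {1..n} \<Longrightarrow> d i \<in> borel_measurable M"
  shows "(\<lambda>\<omega>. bucket_runtime e n (\<lambda>i. d i \<omega>) b c D) \<in> M \<rightarrow>\<^sub>M count_space UNIV"
proof -
  have [measurable]: "(\<lambda>\<omega>. Max ((\<lambda>i. d i \<omega>) ` {1..n})) \<in> borel_measurable M"
    "(\<lambda>\<omega>. Min ((\<lambda>i. d i \<omega>) ` {1..n})) \<in> borel_measurable M"
    using assms by (auto intro: borel_measurable_Max borel_measurable_Min)
  have T: "(\<lambda>\<omega>. num_iterations n (\<lambda>i. d i \<omega>) c D) \<in> M \<rightarrow>\<^sub>M count_space UNIV"
    unfolding num_iterations_def log_def by measurable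
  have "simple_function M
      (\<lambda>\<omega>. 2 * n + 4 + snd (bucket_method e n (\<lambda>i. d i \<omega>) b c T))" for T
    unfolding bucket_method_def Let_def case_prod_beta snd_conv
    by (rule simple_function_compose1[where g = "\<lambda>r. 2 * n + 4 + (n + snd r + 2 + 2 * n)"],
        rule simple_function_outer_loop[where S = "{1..n}"]) (use d in auto)
  then show ?thesis
    unfolding bucket_runtime_def
    by (rule measurable_compose_countable[OF measurable_simple_function T])
qed

section \<open>Expected number of close pairs\<close>

lemma (in prob_space) indep_vars_imp_indep_var:
  assumes "indep_vars N X I" "i \<in> I" "j \<in> I" "i \<noteq> j"
  shows "indep_var (N i) (X i) (N j) (X j)"
proof -
  have "indep_var (PiM {i} N) (\<lambda>\<omega>. restrict (\<lambda>k. X k \<omega>) {i})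
      (PiM {j} N) (\<lambda>\<omega>. restrict (\<lambda>k. X k \<omega>) {j})"
    using assms by (intro indep_var_restrict[OF assms(1)]) auto
  from indep_var_compose[OF this, of "\<lambda>f. f i" "N i" "\<lambda>f. f j" "N j"]
  show ?thesis by (simp add: comp_def)
qed

text \<open>The density is at most \<open>1 / (u - l)\<close> everywhere, which avoids intersecting
  \<open>A\<close> with the support.\<close>

lemma emeasure_uniform_le:
  assumes "l < u" and A: "A \<in> sets borel"
    and Y: "distributed M lborel Y (\<lambda>x. indicator {l..u} x / measure lborel {l..u})"
  shows "emeasure (distr M borel Y) A \<le> ennreal (1 / (u - l)) * emeasure lborel A"
proof -
  have [measurable]: "Y \<in> borel_measurable M"
    using distributed_measurable[OF Y] by simp
  have "emeasure (distr M borel Y) A = emeasure M (Y -` A \<inter> space M)"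
    using A by (simp add: emeasure_distr)
  also have "\<dots> = (\<integral>\<^sup>+x. ennreal (indicator {l..u} x / measure lborel {l..u}) * indicator A x \<partial>lborel)"
    by (rule distributed_emeasure[OF Y]) (use A in simp)
  also have "\<dots> \<le> (\<integral>\<^sup>+x. ennreal (1 / (u - l)) * indicator A x \<partial>lborel)"
    using assms(1)
    by (intro nn_integral_mono) (auto simp: indicator_def)
  also have "\<dots> = ennreal (1 / (u - l)) * emeasure lborel A"
    using A by (simp add: nn_integral_cmult_indicator)
  finally show ?thesis .
qed

text \<open>By independence the joint law is a product. Given \<open>X = x\<close>, closeness
  confines \<open>Y\<close> to an interval of length \<open>2 * \<delta>\<close>, whose probability
  is bounded uniformly in \<open>x\<close>.\<close>

lemma (in prob_space) prob_close_le:
  assumes "l < u" "\<delta> \<ge> 0" and indep: "indep_var borel X borel Y"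
    and Y: "distributed M lborel Y (\<lambda>x. indicator {l..u} x / measure lborel {l..u})"
  shows "prob {\<omega> \<in> space M. \<bar>X \<omega> - Y \<omega>\<bar> \<le> \<delta>} \<le> 2 * \<delta> / (u - l)"
proof -
  have [measurable]: "X \<in> borel_measurable M" "Y \<in> borel_measurable M"
    and eq: "distr M borel X \<Otimes>\<^sub>M distr M borel Y = distr M (borel \<Otimes>\<^sub>M borel) (\<lambda>\<omega>. (X \<omega>, Y \<omega>))"
    using indep unfolding indep_var_distribution_eq by auto
  interpret X: prob_space "distr M borel X" by (rule prob_space_distr) simp
  interpret Y: prob_space "distr M borel Y" by (rule prob_space_distr) simp
  define S where "S = {z :: real \<times> real. \<bar>fst z - snd z\<bar> \<le> \<delta>}"
  have "S = {z \<in> space (borel \<Otimes>\<^sub>M borel). \<bar>fst z - snd z\<bar> \<le> \<delta>}"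
    by (simp add: S_def space_pair_measure)
  also have "\<dots> \<in> sets (borel \<Otimes>\<^sub>M borel)" by measurable
  finally have S: "S \<in> sets (borel \<Otimes>\<^sub>M borel)" .
  then have S': "S \<in> sets (distr M borel X \<Otimes>\<^sub>M distr M borel Y)" by (simp cong: sets_pair_measure_cong)
  have "emeasure M {\<omega> \<in> space M. \<bar>X \<omega> - Y \<omega>\<bar> \<le> \<delta>} = emeasure M ((\<lambda>\<omega>. (X \<omega>, Y \<omega>)) -` S \<inter> space M)"
    by (rule arg_cong[where f = "emeasure M"]) (auto simp: S_def)
  also have "\<dots> = emeasure (distr M borel X \<Otimes>\<^sub>M distr M borel Y) S"
    unfolding eq using S by (intro emeasure_distr[symmetric]) auto
  also have "\<dots> = (\<integral>\<^sup>+x. emeasure (distr M borel Y) (Pair x -` S) \<partial>distr M borel X)"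
    by (rule Y.emeasure_pair_measure_alt[OF S'])
  also have "\<dots> \<le> (\<integral>\<^sup>+x. ennreal (2 * \<delta> / (u - l)) \<partial>distr M borel X)"
  proof (rule nn_integral_mono)
    fix x
    have "Pair x -` S = {x - \<delta>..x + \<delta>}" by (auto simp: S_def)
    then have "emeasure (distr M borel Y) (Pair x -` S)
        \<le> ennreal (1 / (u - l)) * emeasure lborel {x - \<delta>..x + \<delta>}"
      using emeasure_uniform_le[OF assms(1) _ Y] by simp
    also have "\<dots> = ennreal (2 * \<delta> / (u - l))"
      using assms(1,2) by (simp flip: ennreal_mult')
    finally show "emeasure (distr M borel Y) (Pair x -` S) \<le> ennreal (2 * \<delta> / (u - l))" .
  qed
  also have "\<dots> = ennreal (2 * \<delta> / (u - l))"
    using X.emeasure_space_1 by simp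
  finally show ?thesis
    using assms(1,2) by (simp add: emeasure_eq_measure)
qed

lemma (in prob_space) expectation_close_pairs_le:
  assumes "l < u" "\<delta> \<ge> 0" and indep: "indep_vars (\<lambda>_. borel) d {1..n}"
    and d: "\<forall>i\<in>{1..n}. distributed M lborel (d i) (\<lambda>x. indicator {l..u} x / measure lborel {l..u})"
  shows "integrable M (\<lambda>\<omega>. close_pairs (\<lambda>i. d i \<omega>) n \<delta>)"
    "expectation (\<lambda>\<omega>. close_pairs (\<lambda>i. d i \<omega>) n \<delta>) \<le> real n + (real n)\<^sup>2 * (2 * \<delta> / (u - l))"
proof -
  define q where "q = 2 * \<delta> / (u - l)"
  have q: "q \<ge> 0" using assms(1,2) by (simp add: q_def)
  define A where "A = (\<lambda>i j. {\<omega> \<in> space M. \<bar>d i \<omega> - d j \<omega>\<bar> \<le> \<delta>})"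
  have A: "A i j \<in> events" if "i \<in> {1..n}" "j \<in> {1..n}" for i j
  proof -
    have [measurable]: "d i \<in> borel_measurable M" "d j \<in> borel_measurable M"
      using that indep by (auto simp: indep_vars_def)
    show ?thesis unfolding A_def by measurable
  qed
  have eq: "close_pairs (\<lambda>i. d i \<omega>) n \<delta> = (\<Sum>i\<in>{1..n}. \<Sum>j\<in>{1..n}. indicator (A i j) \<omega>)"
    if "\<omega> \<in> space M" for \<omega>
    using that unfolding close_pairs_def A_def
    by (intro sum.cong) (auto simp: indicator_def)
  have int: "integrable M (indicator (A i j) :: 'a \<Rightarrow> real)" if "i \<in> {1..n}" "j \<in> {1..n}" for i j
    using A[OF that] by (simp add: emeasure_eq_measure)
  show "integrable M (\<lambda>\<omega>. close_pairs (\<lambda>i. d i \<omega>) n \<delta>)"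
    by (subst Bochner_Integration.integrable_cong[OF refl eq])
       (intro Bochner_Integration.integrable_sum int | assumption)+
  have "expectation (\<lambda>\<omega>. close_pairs (\<lambda>i. d i \<omega>) n \<delta>)
      = expectation (\<lambda>\<omega>. \<Sum>i\<in>{1..n}. \<Sum>j\<in>{1..n}. indicator (A i j) \<omega>)"
    by (rule Bochner_Integration.integral_cong[OF refl eq])
  also have "\<dots> = (\<Sum>i\<in>{1..n}. \<Sum>j\<in>{1..n}. prob (A i j))"
    using int A
    by (subst Bochner_Integration.integral_sum)
       (auto intro!: sum.cong simp: Bochner_Integration.integral_sum)
  \<comment> \<open>Diagonal pairs are bounded trivially by 1. Adding \<open>q\<close> there as well
    keeps the summand uniform and yields the factor \<open>n\<close> squared.\<close>
  also have "\<dots> \<le> (\<Sum>i\<in>{1..n}. \<Sum>j\<in>{1..n}. of_bool (i = j) + q)"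
  proof (intro sum_mono)
    fix i j assume ij: "i \<in> {1..n}" "j \<in> {1..n}"
    show "prob (A i j) \<le> of_bool (i = j) + q"
    proof (cases "i = j")
      case True
      then show ?thesis using add_mono[OF prob_le_1[of "A i j"] q] by simp
    next
      case False
      then show ?thesis
        using prob_close_le[OF assms(1,2) indep_vars_imp_indep_var[OF indep ij]] d ij
        by (simp add: A_def q_def)
    qed
  qed
  also have "\<dots> = real n + (real n)\<^sup>2 * q"
    by (simp add: sum.distrib power2_eq_square of_bool_def sum.delta algebra_simps)
  finally show "expectation (\<lambda>\<omega>. close_pairs (\<lambda>i. d i \<omega>) n \<delta>)
      \<le> real n + (real n)\<^sup>2 * (2 * \<delta> / (u - l))" by (simp add: q_def)
qed

section \<open>Bounding the average runtime\<close>

lemma sum_power_le: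
  fixes x :: real
  assumes "0 \<le> x" "x < 1"
  shows "(\<Sum>k<T. x ^ k) \<le> 1 / (1 - x)"
  using assms by (simp add: sum_gp_strict divide_right_mono)

text \<open>The guess for the size of the index set after \<open>k\<close> rounds is \<open>n * (3/4) ^ k\<close>: any ratio
  \<open>r\<close> between \<open>1/2\<close> and \<open>1\<close> would make both \<open>r ^ k\<close> and \<open>(1/2) ^ k / r ^ k\<close> summable.\<close>

lemma (in prob_space) expectation_bucket_runtime_le:
  assumes "l < u" "D > 0" "c \<ge> 2" "n \<ge> 1" and indep: "indep_vars (\<lambda>_. borel) d {1..n}"
    and d: "\<forall>i\<in>{1..n}. distributed M lborel (d i) (\<lambda>x. indicator {l..u} x / measure lborel {l..u})"
    and T: "T = nat \<lceil>log 2 ((u - l) / D)\<rceil>" and n: "real n \<ge> real T * (4/3) ^ T"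
  shows "integrable M (\<lambda>\<omega>. real (bucket_runtime e n (\<lambda>i. d i \<omega>) b c D))"
    "expectation (\<lambda>\<omega>. real (bucket_runtime e n (\<lambda>i. d i \<omega>) b c D)) \<le> 100 * real c * real n"
proof -
  define X where "X = (\<lambda>k \<omega>. close_pairs (\<lambda>i. d i \<omega>) n ((u - l) / 2 ^ k))"
  define \<alpha> where "\<alpha> = (\<lambda>k. real n * (3/4) ^ k)"
  define f where "f = (\<lambda>k \<omega>. (\<alpha> k + X k \<omega> / \<alpha> k) / 2)"
  define F where "F = (\<lambda>\<omega>. 5 * real n + 6 + (\<Sum>k<T. 13 * real c + 8 * real c * f k \<omega>))"
  let ?R = "\<lambda>\<omega>. real (bucket_runtime e n (\<lambda>i. d i \<omega>) b c D)"
  have \<alpha>: "\<alpha> k > 0" for k using assms(4) by (simp add: \<alpha>_def)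
  have X: "integrable M (X k)" 
    "expectation (X k) \<le> real n + (real n)\<^sup>2 * (2 * ((u - l) / 2 ^ k) / (u - l))" for k
    unfolding X_def using assms(1) by (intro expectation_close_pairs_le[OF _ _ indep d]; simp)+
  have f: "integrable M (f k)" for k unfolding f_def using X by simp
  have F: "integrable M F" unfolding F_def using f by simp
  \<comment> \<open>The uniform law confines the data to the interval only almost surely, so the
    deterministic bound by \<open>F\<close> holds almost everywhere.\<close>
  have "AE \<omega> in M. d i \<omega> \<in> {l..u}" if i: "i \<in> {1..n}" for i
  proof -
    have "distributed M lborel (d i) (\<lambda>x. indicator {l..u} x / measure lborel {l..u})"
      using d i by blast
    then show ?thesis
      by (subst distributed_AE2) (auto simp: indicator_def)
  qed
  then have "AE \<omega> in M. \<forall>i\<in>{1..n}. d i \<omega> \<in> {l..u}"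
    by (intro AE_finite_allI) auto
  then have le: "AE \<omega> in M. ?R \<omega> \<le> F \<omega>"
  proof (rule AE_mp, intro AE_I2 impI)
    fix \<omega> assume \<omega>: "\<forall>i\<in>{1..n}. d i \<omega> \<in> {l..u}"
    show "?R \<omega> \<le> F \<omega>"
      unfolding F_def
    proof (rule bucket_runtime_le[where W = "u - l"])
      show "num_iterations n (\<lambda>i. d i \<omega>) c D \<le> T"
        unfolding T using \<omega> by (intro num_iterations_le assms) auto
      show "\<forall>i\<in>{1..n}. \<forall>j\<in>{1..n}. d i \<omega> - d j \<omega> \<le> u - l"
        using \<omega> by (smt (verit) atLeastAtMost_iff)
    next
      fix k J assume "J \<subseteq> {1..n}" "\<forall>i\<in>J. \<forall>j\<in>J. d i \<omega> - d j \<omega> \<le> (u - l) / 2 ^ k"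
      then show "real (card J) \<le> f k \<omega>"
        unfolding f_def X_def by (rule card_le_close_pairs) (rule \<alpha>)
    qed (rule assms)
  qed
  have "(\<lambda>\<omega>. bucket_runtime e n (\<lambda>i. d i \<omega>) b c D) \<in> M \<rightarrow>\<^sub>M count_space UNIV"
    using indep by (intro measurable_bucket_runtime) (auto simp: indep_vars_def)
  then have "?R \<in> borel_measurable M" by simp
  then show int: "integrable M ?R"
    by (rule Bochner_Integration.integrable_bound[OF F]) (use le in \<open>auto intro: AE_mp\<close>)
  \<comment> \<open>The three terms come from the guess \<alpha>, the diagonal pairs and the
    off-diagonal pairs. The middle one grows with \<open>k\<close> and is frozen at its value for
    \<open>T\<close>.\<close>
  have Ef: "expectation (f k) \<le> real n * (3/4) ^ k / 2 + (4/3) ^ T / 2 + real n * (2/3) ^ k"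
    if "k < T" for k
  proof -
    have "expectation (f k) = (\<alpha> k + expectation (X k) / \<alpha> k) / 2"
      unfolding f_def using X by (simp add: prob_space)
    also have "\<dots> \<le> (\<alpha> k + (real n + (real n)\<^sup>2 * (2 * ((u - l) / 2 ^ k) / (u - l))) / \<alpha> k) / 2"
      using X \<alpha>[of k] by (intro divide_right_mono add_left_mono) auto
    also have "\<dots> = real n * (3/4) ^ k / 2 + (4/3) ^ k / 2 + real n * (2/3) ^ k"
    proof -
      have inv: "x / \<alpha> k = x * ((4/3) ^ k / real n)" for x
        by (simp add: \<alpha>_def power_divide)
      have half: "2 * ((u - l) / 2 ^ k) / (u - l) = 2 * (1/2) ^ k"
        using assms(1) by (simp add: divide_simps)
      have two_thirds: "(2/3) ^ k = (1/2::real) ^ k * (4/3) ^ k"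
        by (simp flip: power_mult_distrib)
      show ?thesis
        unfolding inv half two_thirds using assms(4)
        by (simp add: \<alpha>_def power2_eq_square add_divide_distrib distrib_right)
    qed
    also have "(4/3::real) ^ k \<le> (4/3) ^ T"
      using that by (intro power_increasing) auto
    finally show ?thesis by simp
  qed
  have "(\<Sum>k<T. expectation (f k))
      \<le> (\<Sum>k<T. real n * (3/4) ^ k / 2 + (4/3) ^ T / 2 + real n * (2/3) ^ k)"
    by (intro sum_mono Ef) simp
  also have "\<dots> = real n / 2 * (\<Sum>k<T. (3/4) ^ k) + real T * (4/3) ^ T / 2 + real n * (\<Sum>k<T. (2/3) ^ k)"
    by (simp add: sum.distrib sum_distrib_left mult_ac)
  \<comment> \<open>The geometric series sum to at most 4 and 3, and the assumed lower bound on
    \<open>n\<close> absorbs the middle term.\<close>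
  also have "\<dots> \<le> real n / 2 * 4 + real n / 2 + real n * 3"
    using n sum_power_le[of "3/4" T] sum_power_le[of "2/3" T]
    by (intro add_mono mult_left_mono) auto
  finally have sum_f: "(\<Sum>k<T. expectation (f k)) \<le> 6 * real n" by simp
  have T_n: "real T \<le> real n"
    using n mult_left_mono[OF one_le_power[of "4/3::real" T], of "real T"] by simp
  have "expectation ?R \<le> expectation F" using int F le by (rule integral_mono_AE)
  also have "\<dots> = 5 * real n + 6 + 13 * real c * real T + 8 * real c * (\<Sum>k<T. expectation (f k))"
    unfolding F_def using f by (simp add: prob_space sum.distrib sum_distrib_left)
  also have "\<dots> \<le> 5 * real n + 6 + 13 * real c * real n + 8 * real c * (6 * real n)"
    using T_n sum_f by (intro add_mono mult_left_mono) auto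
  \<comment> \<open>Here 61 = 13 + 48, and 6 is at most \<open>6 * n\<close>. As \<open>c\<close> is
    at least 1, 72 would do in place of the round constant 100.\<close>
  also have "\<dots> \<le> 11 * real n + 61 * (real c * real n)" using assms(4) by simp
  also have "\<dots> \<le> 100 * real c * real n"
    using mult_right_mono[of 1 "real c" "real n"] assms(3) by simp
  finally show "expectation ?R \<le> 100 * real c * real n" .
qed

theorem proposition8:
  shows "\<exists>C::real. \<forall>(l::real) (u::real) (D::real). l < u \<longrightarrow> D > 0 \<longrightarrow>
    (\<exists>N::nat. \<forall>n\<ge>N. \<forall>c\<ge>2. \<forall>(b::real)>0. \<forall>(e::bool) (M::'a measure) (d::nat \<Rightarrow> 'a \<Rightarrow> real).
      prob_space M \<longrightarrow>
      prob_space.indep_vars M (\<lambda>_. borel) d {1..n} \<longrightarrow>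
      (\<forall>i\<in>{1..n}. distributed M lborel (d i) (\<lambda>x. indicator {l..u} x / measure lborel {l..u})) \<longrightarrow>
      integrable M (\<lambda>\<omega>. real (bucket_runtime e n (\<lambda>i. d i \<omega>) b c D)) \<and>
      prob_space.expectation M (\<lambda>\<omega>. real (bucket_runtime e n (\<lambda>i. d i \<omega>) b c D))
        \<le> C * real c * real n)"
proof (rule exI[of _ 100], intro allI impI)
  fix l u D :: real
  assume lu: "l < u" "D > 0"
  define T where "T = nat \<lceil>log 2 ((u - l) / D)\<rceil>"
  \<comment> \<open>\<open>N\<close> depends on \<open>l\<close>, \<open>u\<close>, \<open>D\<close>
    only, through \<open>T\<close>, while 100 is absolute. The maximum with 1 makes the index set
    nonempty.\<close>
  define N where "N = max 1 (nat \<lceil>real T * (4/3) ^ T\<rceil>)"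
  have N: "n \<ge> 1" "real n \<ge> real T * (4/3) ^ T" if "n \<ge> N" for n
    using that unfolding N_def by linarith+
  show "\<exists>N::nat. \<forall>n\<ge>N. \<forall>c\<ge>2. \<forall>(b::real)>0. \<forall>(e::bool) (M::'a measure) (d::nat \<Rightarrow> 'a \<Rightarrow> real).
      prob_space M \<longrightarrow>
      prob_space.indep_vars M (\<lambda>_. borel) d {1..n} \<longrightarrow>
      (\<forall>i\<in>{1..n}. distributed M lborel (d i) (\<lambda>x. indicator {l..u} x / measure lborel {l..u})) \<longrightarrow>
      integrable M (\<lambda>\<omega>. real (bucket_runtime e n (\<lambda>i. d i \<omega>) b c D)) \<and>
      prob_space.expectation M (\<lambda>\<omega>. real (bucket_runtime e n (\<lambda>i. d i \<omega>) b c D))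
        \<le> 100 * real c * real n"
    using prob_space.expectation_bucket_runtime_le[OF _ lu _ _ _ _ T_def] N
    by (intro exI[of _ N]) blast
qed

end
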